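(* The ring $(D_q)_0$ of homogeneous $q$-differential operators of degree $0$ on $R=\Bbbk[x]$ is $\Bbbk[\sigma,\tau,\sigma^{-1}]$, the localization at $\sigma$ of the (commutative) polynomial ring $\Bbbk[\tau,\sigma]$ in the two indeterminates $\tau=x\partial$ and $\sigma=\sigma_1$.
   Context: Let $q$ be transcendental over $\mathbb{Q}$, let $\Bbbk$ be a field containing $\mathbb{Q}(q)$, and let $R=\Bbbk[x]$ be $\mathbb{Z}$-graded by $\deg x^a=a$, with bicharacter $\beta(n,m)=q^{nm}$ on $\mathbb{Z}$. A $\Bbbk$-linear endomorphism $\varphi$ of $R$ is homogeneous of degree $d\in\mathbb{Z}$ if $\varphi(R_b)\subseteq R_{b+d}$ for all $b\in\mathbb Z$, where $R_b=\Bbbk x^b$ for $b\ge0$ and $R_b=0$ for $b<0$. $\mathrm{grHom}_\Bbbk(R,R)$ is the space of finite sums of homogeneous endomorphisms. Each $r\in R$ is identified with the operator of multiplication by $r$; $\mathrm{grHom}_\Bbbk(R,R)$ is an $R$-bimodule via composition. For $a\in\mathbb{Z}$ put $\widetilde\sigma_a(\psi)=q^{ad}\psi$ for $\psi$ homogeneous of degree $d$ (extended linearly), and $[\varphi,\psi]_a=\varphi\psi-\widetilde\sigma_a(\psi)\varphi$. $q$-differential operators: $D_q^0$ is the smallest $R$-sub-bimodule of $\mathrm{grHom}_\Bbbk(R,R)$ containing all homogeneous $\varphi$ for which there is $a\in\mathbb{Z}$ with $[\varphi,r]_a=0$ for all $r\in R$. Inductively, $D_q^{n+1}$ is the smallest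 $R$-sub-bimodule containing all homogeneous $\varphi$ for which there is $a\in\mathbb{Z}$ with $[\varphi,r]_a\in D_q^n$ for all $r\in R$. Put $D_q=\bigcup_{n\ge 0} D_q^n$; it is a ring under composition. $(D_q)_0$ denotes the subring of elements of $D_q$ that are homogeneous of degree $0$. $\partial$ is the usual derivative $\partial(x^b)=bx^{b-1}$, $\sigma_a(x^b)=q^{ab}x^b$, $\sigma=\sigma_1$, $\sigma^{-1}=\sigma_{-1}$, $\tau=x\partial$. *)

theory Defs
  imports "HOL-Algebra.Generated_Rings" "HOL-Computational_Algebra.Computational_Algebra"
begin

text \<open>
  The graded algebra \<open>R = k[x]\<close> is the type \<open>'k poly\<close>, where \<open>'k\<close> is a field of
  characteristic \<open>0\<close>; that \<open>'k\<close> contains \<open>Q(q)\<close> with \<open>q\<close> transcendental is expressed by an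
  element \<open>q :: 'k\<close> with \<open>\<not> algebraic q\<close>.
\<close>

definition R_comp :: "int \<Rightarrow> 'k::field_char_0 poly set" where
  "R_comp b = (if b \<ge> 0 then range (\<lambda>c. Polynomial.monom c (nat b)) else {0})"

definition is_endo :: "('k::field_char_0 poly \<Rightarrow> 'k poly) \<Rightarrow> bool" where
  "is_endo \<phi> \<longleftrightarrow> Vector_Spaces.linear Polynomial.smult Polynomial.smult \<phi>"

definition homog :: "int \<Rightarrow> ('k::field_char_0 poly \<Rightarrow> 'k poly) \<Rightarrow> bool" where
  "homog d \<phi> \<longleftrightarrow> is_endo \<phi> \<and> (\<forall>b. \<phi> ` R_comp b \<subseteq> R_comp (b + d))"

text \<open>
  Sums of homogeneous endomorphisms of one fixed degree are homogeneous of that degree, so a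
  finite sum of homogeneous endomorphisms can be indexed by a finite set of degrees.
\<close>

definition grHom :: "('k::field_char_0 poly \<Rightarrow> 'k poly) set" where
  "grHom = {(\<lambda>p. \<Sum>d\<in>D. \<Phi> d p) | D \<Phi>. finite D \<and> (\<forall>d\<in>D. homog d (\<Phi> d))}"

definition mult_op :: "'k::field_char_0 poly \<Rightarrow> 'k poly \<Rightarrow> 'k poly" where
  "mult_op r = (\<lambda>p. r * p)"

definition sub_bimodule :: "('k::field_char_0 poly \<Rightarrow> 'k poly) set \<Rightarrow> bool" where
  "sub_bimodule M \<longleftrightarrow> M \<subseteq> grHom \<and> (\<lambda>_. 0) \<in> M \<and>
     (\<forall>\<phi>\<in>M. \<forall>\<psi>\<in>M. (\<lambda>p. \<phi> p + \<psi> p) \<in> M) \<and>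
     (\<forall>r. \<forall>\<phi>\<in>M. mult_op r \<circ> \<phi> \<in> M \<and> \<phi> \<circ> mult_op r \<in> M)"

definition bimodule_span ::
    "('k::field_char_0 poly \<Rightarrow> 'k poly) set \<Rightarrow> ('k poly \<Rightarrow> 'k poly) set" where
  "bimodule_span S = \<Inter>{M. sub_bimodule M \<and> S \<subseteq> M}"

definition bichar :: "'k::field_char_0 \<Rightarrow> int \<Rightarrow> int \<Rightarrow> 'k" where
  "bichar q n m = q powi (n * m)"

text \<open>
  The operator \<open>twist q a\<close> multiplies the homogeneous component of degree \<open>d\<close> by \<open>q\<^sup>a\<^sup>d\<close>.
  It is meaningful on \<^const>\<open>grHom\<close> only; lemmas \<open>twist_sum\<close> and \<open>twist_homog\<close> below
  show that it is well defined there.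
\<close>

definition twist ::
    "'k::field_char_0 \<Rightarrow> int \<Rightarrow> ('k poly \<Rightarrow> 'k poly) \<Rightarrow> 'k poly \<Rightarrow> 'k poly" where
  "twist q a \<psi> = (THE \<chi>. \<exists>D \<Phi>. finite D \<and> (\<forall>d\<in>D. homog d (\<Phi> d)) \<and>
      \<psi> = (\<lambda>p. \<Sum>d\<in>D. \<Phi> d p) \<and>
      \<chi> = (\<lambda>p. \<Sum>d\<in>D. Polynomial.smult (bichar q a d) (\<Phi> d p)))"

definition q_bracket ::
    "'k::field_char_0 \<Rightarrow> int \<Rightarrow> ('k poly \<Rightarrow> 'k poly) \<Rightarrow> ('k poly \<Rightarrow> 'k poly) \<Rightarrow> 'k poly \<Rightarrow> 'k poly"
  where "q_bracket q a \<phi> \<psi> = (\<lambda>p. \<phi> (\<psi> p) - twist q a \<psi> (\<phi> p))"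

primrec Dq_upto :: "'k::field_char_0 \<Rightarrow> nat \<Rightarrow> ('k poly \<Rightarrow> 'k poly) set" where
  "Dq_upto q 0 = bimodule_span
     {\<phi>. (\<exists>d. homog d \<phi>) \<and> (\<exists>a. \<forall>r. q_bracket q a \<phi> (mult_op r) = (\<lambda>_. 0))}"
| "Dq_upto q (Suc n) = bimodule_span
     {\<phi>. (\<exists>d. homog d \<phi>) \<and> (\<exists>a. \<forall>r. q_bracket q a \<phi> (mult_op r) \<in> Dq_upto q n)}"

definition Dq :: "'k::field_char_0 \<Rightarrow> ('k poly \<Rightarrow> 'k poly) set" where
  "Dq q = (\<Union>n. Dq_upto q n)"

definition Dq_deg0 :: "'k::field_char_0 \<Rightarrow> ('k poly \<Rightarrow> 'k poly) set" where
  "Dq_deg0 q = {\<phi> \<in> Dq q. homog 0 \<phi>}"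

definition End_ring :: "('k::field_char_0 poly \<Rightarrow> 'k poly) ring" where
  "End_ring = \<lparr>carrier = Collect is_endo, monoid.mult = (\<lambda>\<phi> \<psi>. \<phi> \<circ> \<psi>), one = id,
     zero = (\<lambda>_. 0), add = (\<lambda>\<phi> \<psi> p. \<phi> p + \<psi> p)\<rparr>"

definition sigma_op :: "'k::field_char_0 \<Rightarrow> int \<Rightarrow> 'k poly \<Rightarrow> 'k poly" where
  "sigma_op q a p =
     (\<Sum>b\<le>Polynomial.degree p. Polynomial.monom (q powi (a * int b) * Polynomial.coeff p b) b)"

definition tau_op :: "'k::field_char_0 poly \<Rightarrow> 'k poly" where
  "tau_op p = [:0, 1:] * pderiv p"

definition scalar_op :: "'k::field_char_0 \<Rightarrow> 'k poly \<Rightarrow> 'k poly" where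
  "scalar_op c = (\<lambda>p. Polynomial.smult c p)"

text \<open>
  The localization of an integral domain at (the powers of) a nonzero element \<open>s\<close>, realised
  inside the field of fractions.
\<close>

definition localization_at :: "'a::idom \<Rightarrow> 'a fract ring" where
  "localization_at s = \<lparr>carrier = {Fract f (s ^ n) | f n. True}, monoid.mult = (*), one = 1,
     zero = 0, add = (+)\<rparr>"

text \<open>
  The polynomial ring \<open>k[\<tau>,\<sigma>]\<close> in two indeterminates is \<open>'k poly poly = k[\<tau>][\<sigma>]\<close>:
  the inner indeterminate is \<open>\<tau>\<close>, the outer one is \<open>\<sigma>\<close>.
\<close>

definition sigma_var :: "'k::field_char_0 poly poly" where
  "sigma_var = [:0, 1:]"

definition tau_var :: "'k::field_char_0 poly poly" where
  "tau_var = [:[:0, 1:]:]"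

definition const_var :: "'k::field_char_0 \<Rightarrow> 'k poly poly" where
  "const_var c = [:[:c:]:]"

lemma vector_space_smult: "vector_space (Polynomial.smult :: 'k::field \<Rightarrow> 'k poly \<Rightarrow> 'k poly)"
  by unfold_locales (auto simp: smult_add_right smult_add_left)

lemma is_endo_iff:
  "is_endo \<phi> \<longleftrightarrow> (\<forall>p r. \<phi> (p + r) = \<phi> p + \<phi> r) \<and>
     (\<forall>c p. \<phi> (Polynomial.smult c p) = Polynomial.smult c (\<phi> p))"
  unfolding is_endo_def Vector_Spaces.linear_def module_hom_def module_hom_axioms_def
  using vector_space_smult module_iff_vector_space by blast

lemma endo_sum: "is_endo \<phi> \<Longrightarrow> \<phi> (sum f A) = (\<Sum>i\<in>A. \<phi> (f i))"
proof (induction A rule: infinite_finite_induct)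
  case (infinite A)
  then have "\<phi> (Polynomial.smult 0 0) = Polynomial.smult 0 (\<phi> 0)"
    unfolding is_endo_iff by blast
  with infinite show ?case by simp
next
  case empty
  then have "\<phi> (Polynomial.smult 0 0) = Polynomial.smult 0 (\<phi> 0)"
    unfolding is_endo_iff by blast
  then show ?case by simp
qed (auto simp: is_endo_iff)

lemma endo_eqI:
  fixes \<phi> \<psi> :: "'k::field_char_0 poly \<Rightarrow> 'k poly"
  assumes "is_endo \<phi>" "is_endo \<psi>" "\<And>b. \<phi> (Polynomial.monom 1 b) = \<psi> (Polynomial.monom 1 b)"
  shows "\<phi> = \<psi>"
proof
  fix p :: "'k poly"
  have p: "p = (\<Sum>b\<le>Polynomial.degree p. Polynomial.smult (Polynomial.coeff p b) (Polynomial.monom 1 b))"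
    by (simp only: Polynomial.smult_monom mult_1_right poly_as_sum_of_monoms)
  have *: "\<chi> p = (\<Sum>b\<le>Polynomial.degree p. Polynomial.smult (Polynomial.coeff p b) (\<chi> (Polynomial.monom 1 b)))"
    if "is_endo \<chi>" for \<chi>
    by (subst p, subst endo_sum[OF that]) (use that in \<open>simp add: is_endo_iff\<close>)
  show "\<phi> p = \<psi> p" using *[OF assms(1)] *[OF assms(2)] assms(3) by simp
qed

lemma homog_coeff:
  assumes "homog d \<phi>" "int n \<noteq> int b + d"
  shows "Polynomial.coeff (\<phi> (Polynomial.monom c b)) n = 0"
proof -
  have "Polynomial.monom c b \<in> R_comp (int b)" by (auto simp: R_comp_def)
  then have "\<phi> (Polynomial.monom c b) \<in> R_comp (int b + d)"
    using assms(1) unfolding homog_def by blast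
  then show ?thesis using assms(2) by (auto simp: R_comp_def split: if_splits)
qed

lemma smult_sum_right: "Polynomial.smult c (sum f A) = (\<Sum>i\<in>A. Polynomial.smult c (f i))"
  by (induction A rule: infinite_finite_induct) (auto simp: smult_add_right)

lemma twist_sum:
  assumes "finite D" "\<And>d. d \<in> D \<Longrightarrow> homog d (\<Phi> d)"
  shows "twist q a (\<lambda>p. \<Sum>d\<in>D. \<Phi> d p) =
    (\<lambda>p. \<Sum>d\<in>D. Polynomial.smult (bichar q a d) (\<Phi> d p))"
proof -
  have c: "Polynomial.coeff (\<Sum>d\<in>E. Polynomial.smult (bichar q a d) (\<Psi> d (Polynomial.monom 1 b))) n =
      bichar q a (int n - int b) * Polynomial.coeff (\<Sum>d\<in>E. \<Psi> d (Polynomial.monom 1 b)) n"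
    if "\<forall>d\<in>E. homog d (\<Psi> d)" for E \<Psi> b n
    unfolding coeff_sum sum_distrib_left
  proof (rule sum.cong)
    fix d assume "d \<in> E"
    then show "Polynomial.coeff (Polynomial.smult (bichar q a d) (\<Psi> d (Polynomial.monom 1 b))) n =
      bichar q a (int n - int b) * Polynomial.coeff (\<Psi> d (Polynomial.monom 1 b)) n"
      using homog_coeff[of d "\<Psi> d" n b 1] that by (cases "int n = int b + d") auto
  qed simp
  have e: "is_endo (\<lambda>p. \<Sum>d\<in>E. Polynomial.smult (bichar q a d) (\<Psi> d p))"
    if "\<forall>d\<in>E. homog d (\<Psi> d)" for E \<Psi>
    using that unfolding is_endo_iff homog_def
    by (auto simp: smult_add_right sum.distrib mult.commute smult_sum_right intro!: sum.cong)
  show ?thesis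
    unfolding twist_def
  proof (rule the_equality)
    fix \<chi>
    assume "\<exists>E \<Psi>. finite E \<and> (\<forall>d\<in>E. homog d (\<Psi> d)) \<and>
        (\<lambda>p. \<Sum>d\<in>D. \<Phi> d p) = (\<lambda>p. \<Sum>d\<in>E. \<Psi> d p) \<and>
        \<chi> = (\<lambda>p. \<Sum>d\<in>E. Polynomial.smult (bichar q a d) (\<Psi> d p))"
    then obtain E \<Psi> where h: "\<forall>d\<in>E. homog d (\<Psi> d)"
      and eq: "(\<lambda>p. \<Sum>d\<in>D. \<Phi> d p) = (\<lambda>p. \<Sum>d\<in>E. \<Psi> d p)"
      and \<chi>: "\<chi> = (\<lambda>p. \<Sum>d\<in>E. Polynomial.smult (bichar q a d) (\<Psi> d p))" by blast
    have hD: "\<forall>d\<in>D. homog d (\<Phi> d)" using assms(2) by blast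
    show "\<chi> = (\<lambda>p. \<Sum>d\<in>D. Polynomial.smult (bichar q a d) (\<Phi> d p))"
      unfolding \<chi>
    proof (rule endo_eqI[OF e[OF h] e[OF hD]])
      fix b
      show "(\<Sum>d\<in>E. Polynomial.smult (bichar q a d) (\<Psi> d (Polynomial.monom 1 b))) =
            (\<Sum>d\<in>D. Polynomial.smult (bichar q a d) (\<Phi> d (Polynomial.monom 1 b)))"
        by (rule poly_eqI) (simp add: c[OF h] c[OF hD] fun_cong[OF eq])
    qed
  qed (use assms in blast)
qed

lemma twist_homog:
  assumes "homog d \<psi>"
  shows "twist q a \<psi> = (\<lambda>p. Polynomial.smult (bichar q a d) (\<psi> p))"
  using twist_sum[of "{d}" "\<lambda>_. \<psi>" q a] assms by simp

lemma sigma_op_monom: "sigma_op q a (Polynomial.monom 1 b) = Polynomial.monom (q powi (a * int b)) b"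
proof -
  have "sigma_op q a (Polynomial.monom 1 b) =
      (\<Sum>i\<le>b. if i = b then Polynomial.monom (q powi (a * int b)) b else 0)"
    unfolding sigma_op_def by (rule sum.cong) (auto simp: Polynomial.degree_monom_eq)
  then show ?thesis by simp
qed

end

theory Submission
  imports Defs
begin

text \<open>
  A homogeneous endomorphism of degree \<open>d\<close> is given by its weight \<open>f\<close>, the sequence with
  \<open>\<phi>(x^b) = f(b) x^(b + d)\<close>, and the twisted bracket with \<open>x\<close> acts on weights as the difference
  operator \<open>f(b + 1) - q^a f(b)\<close>.  Hence the theorem is about the sequences that become zero
  after repeated application of such operators, and these are the exponential polynomials
  \<open>F(b, q^b) / q^(n b)\<close> with \<open>F\<close> in \<open>k[t, s]\<close>.

  Upper bound: the operators with finitely many nonzero weights, all of them exponential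
  polynomials, form a sub-bimodule (\<open>sub_bimodule_qexp_ops\<close>), and the difference equation
  \<open>f(b + 1) - q^a f(b) = h(b)\<close> with an exponential polynomial \<open>h\<close> has only exponential polynomials
  as solutions (\<open>exp_polys_difference_eq\<close>).  This rests on the surjectivity of
  \<open>u(t) \<mapsto> \<alpha> u(t + 1) - \<beta> u(t)\<close> on \<open>k[t]\<close>, which uses characteristic zero if \<open>\<alpha> = \<beta>\<close>.  So the
  sub-bimodule contains every quantum differential operator.

  Lower bound: the operator with weight \<open>q^(a b) p(b)\<close> in degree \<open>0\<close> lies in the layer of the
  filtration numbered by the degree of \<open>p\<close> (\<open>exp_diag_op_in_Dq_upto\<close>), because its bracket with
  \<open>x^m\<close> replaces \<open>p(t)\<close> by a multiple of \<open>p(t + m) - p(t)\<close>.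

  Therefore the ring in degree \<open>0\<close> consists of the diagonal operators whose weight is an exponential
  polynomial (\<open>Dq_deg0_eq\<close>).  Diagonal operators compose by multiplying their weights;
  \<open>\<sigma>\<close>, its inverse and \<open>\<tau>\<close> have the weights \<open>q^b\<close>, \<open>q^(-b)\<close> and \<open>b\<close>, so they generate the ring
  together with the scalars.  The ring is the localized polynomial ring because \<open>F\<close> is determined
  by its values \<open>F(b, q^b)\<close> as soon as the powers of \<open>q\<close> are distinct (\<open>exp_eval_eq_0_imp\<close>).
\<close>

section \<open>Difference operators on polynomials\<close>

definition difference_op :: "'k \<Rightarrow> 'k \<Rightarrow> 'k::field_char_0 poly \<Rightarrow> 'k poly" where
  "difference_op \<alpha> \<beta> u =
     Polynomial.smult \<alpha> (pcompose u [:1, 1:]) - Polynomial.smult \<beta> u"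

lemma poly_difference_op:
  "poly (difference_op \<alpha> \<beta> u) t = \<alpha> * poly u (t + 1) - \<beta> * poly u t"
  by (simp add: difference_op_def poly_pcompose add.commute)

lemma difference_op_add:
  "difference_op \<alpha> \<beta> (u + v) = difference_op \<alpha> \<beta> u + difference_op \<alpha> \<beta> v"
  by (simp add: difference_op_def pcompose_add smult_add_right)

lemma difference_op_smult:
  "difference_op \<alpha> \<beta> (Polynomial.smult c u) = Polynomial.smult c (difference_op \<alpha> \<beta> u)"
  by (simp add: difference_op_def pcompose_smult smult_diff_right mult.commute)

lemma degree_translate:
  "Polynomial.degree (pcompose u [:c, 1:]) = Polynomial.degree (u :: 'k::field_char_0 poly)"
  by (simp add: degree_pcompose)

lemma coeff_degree_translate:
  "Polynomial.coeff (pcompose u [:c, 1:]) (Polynomial.degree u) =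
     Polynomial.lead_coeff (u :: 'k::field_char_0 poly)"
  using lead_coeff_comp[of "[:c, 1:]" u] by (simp add: degree_translate)

lemma degree_difference_op_le:
  "Polynomial.degree (difference_op \<alpha> \<beta> u) \<le> Polynomial.degree u"
  unfolding difference_op_def
  by (intro degree_diff_le order_trans[OF degree_smult_le]) (simp_all add: degree_translate)

lemma coeff_difference_op_top:
  "Polynomial.coeff (difference_op \<alpha> \<beta> u) (Polynomial.degree u) =
     (\<alpha> - \<beta>) * Polynomial.lead_coeff u"
  by (simp add: difference_op_def coeff_degree_translate left_diff_distrib)

lemma degree_difference_op_less:
  assumes "difference_op \<alpha> \<alpha> u \<noteq> 0"
  shows "Polynomial.degree (difference_op \<alpha> \<alpha> u) < Polynomial.degree u"
proof -
  have "Polynomial.coeff (difference_op \<alpha> \<alpha> u) (Polynomial.degree u) = 0"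
    by (simp add: coeff_difference_op_top)
  then have "Polynomial.degree (difference_op \<alpha> \<alpha> u) \<noteq> Polynomial.degree u"
    using assms by (metis leading_coeff_neq_0)
  then show ?thesis using degree_difference_op_le[of \<alpha> \<alpha> u] by linarith
qed

lemma degree_translate_diff_le:
  "Polynomial.degree (pcompose p [:c, 1:] - p) \<le> Polynomial.degree (p :: 'k::field_char_0 poly) - 1"
proof (rule degree_le, intro allI impI)
  fix i assume "Polynomial.degree p - 1 < i"
  then consider "i = Polynomial.degree p" | "i > Polynomial.degree p" by linarith
  then show "Polynomial.coeff (pcompose p [:c, 1:] - p) i = 0"
    by cases (simp_all add: coeff_degree_translate coeff_eq_0 degree_translate)
qed

text \<open>
  In the resonant case \<open>\<alpha> = \<beta>\<close> the operator lowers degrees by exactly one, because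
  \<open>(t + 1)^(n + 1) - t^(n + 1)\<close> has leading coefficient \<open>n + 1\<close>, which is invertible in
  characteristic zero.  Otherwise it preserves degrees.
\<close>
lemma ex_difference_op_degree:
  fixes \<alpha> \<beta> :: "'k::field_char_0"
  assumes "\<alpha> \<noteq> 0"
  shows "\<exists>u. Polynomial.degree (difference_op \<alpha> \<beta> u) = n \<and> difference_op \<alpha> \<beta> u \<noteq> 0"
proof (cases "\<alpha> = \<beta>")
  case False
  let ?u = "Polynomial.monom (1::'k) n"
  have "Polynomial.coeff (difference_op \<alpha> \<beta> ?u) n = \<alpha> - \<beta>"
    using coeff_difference_op_top[of \<alpha> \<beta> ?u] by (simp add: Polynomial.degree_monom_eq)
  moreover have "Polynomial.degree (difference_op \<alpha> \<beta> ?u) \<le> n"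
    using degree_difference_op_le[of \<alpha> \<beta> ?u] by (simp add: Polynomial.degree_monom_eq)
  ultimately show ?thesis using False
    by (metis coeff_0 eq_iff_diff_eq_0 le_degree order_antisym)
next
  case True
  let ?u = "Polynomial.monom (1::'k) (Suc n)"
  have "pcompose ?u [:1, 1:] = [:1, 1:] ^ Suc n"
    by (induction n) (simp_all add: Polynomial.monom_Suc monom_0 pcompose_pCons)
  then have "Polynomial.coeff (difference_op \<alpha> \<beta> ?u) n = \<alpha> * of_nat (Suc n)"
    using True by (simp add: difference_op_def coeff_linear_poly_power del: power_Suc of_nat_Suc)
  moreover have "\<alpha> * of_nat (Suc n) \<noteq> 0" using assms by (simp del: of_nat_Suc)
  moreover have "Polynomial.degree (difference_op \<alpha> \<beta> ?u) \<le> n"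
    using degree_difference_op_less[of \<alpha> ?u] True
    by (cases "difference_op \<alpha> \<beta> ?u = 0") (auto simp: Polynomial.degree_monom_eq)
  ultimately show ?thesis by (metis coeff_0 le_degree order_antisym)
qed

text \<open>
  The image contains a polynomial of every degree, so leading terms can be removed one after the
  other.
\<close>
lemma difference_op_surj:
  fixes \<alpha> \<beta> :: "'k::field_char_0"
  assumes "\<alpha> \<noteq> 0"
  shows "\<exists>u. difference_op \<alpha> \<beta> u = p"
proof (induction "Polynomial.degree p" arbitrary: p rule: less_induct)
  case less
  obtain v where v: "Polynomial.degree (difference_op \<alpha> \<beta> v) = Polynomial.degree p"
      "difference_op \<alpha> \<beta> v \<noteq> 0"
    using ex_difference_op_degree[OF assms] by blast
  define c where "c = Polynomial.lead_coeff p / Polynomial.lead_coeff (difference_op \<alpha> \<beta> v)"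
  define r where "r = p - difference_op \<alpha> \<beta> (Polynomial.smult c v)"
  have "Polynomial.coeff r (Polynomial.degree p) = 0"
    using v leading_coeff_neq_0[OF v(2)] by (simp add: r_def difference_op_smult c_def)
  moreover have "Polynomial.degree r \<le> Polynomial.degree p"
    unfolding r_def difference_op_smult using v(1)
    by (intro degree_diff_le order_trans[OF degree_smult_le]) simp_all
  ultimately consider "r = 0" | "Polynomial.degree r < Polynomial.degree p"
    by (metis leading_coeff_0_iff le_neq_implies_less)
  then obtain w where "difference_op \<alpha> \<beta> w = r"
  proof cases
    case 1
    then show ?thesis using that[of 0] by (simp add: difference_op_def)
  next
    case 2
    then show ?thesis using less that by blast
  qed
  then have "difference_op \<alpha> \<beta> (w + Polynomial.smult c v) = p"
    by (simp add: difference_op_add r_def)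
  then show ?case by blast
qed

section \<open>Exponential polynomials\<close>

text \<open>
  The value \<open>F(b, q^b)\<close>: the inner variable \<open>t\<close> is evaluated at \<open>b\<close>, the outer variable \<open>s\<close>
  at \<open>q^b\<close>.
\<close>
definition exp_eval :: "'k::field_char_0 \<Rightarrow> 'k poly poly \<Rightarrow> nat \<Rightarrow> 'k" where
  "exp_eval q F b = poly (poly F [:q ^ b:]) (of_nat b)"

lemma exp_eval_simps [simp]:
  "exp_eval q 0 b = 0"
  "exp_eval q 1 b = 1"
  "exp_eval q (F + G) b = exp_eval q F b + exp_eval q G b"
  "exp_eval q (F - G) b = exp_eval q F b - exp_eval q G b"
  "exp_eval q (F * G) b = exp_eval q F b * exp_eval q G b"
  "exp_eval q (F ^ n) b = exp_eval q F b ^ n"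
  "exp_eval q (pCons p F) b = poly p (of_nat b) + q ^ b * exp_eval q F b"
  "exp_eval q (Polynomial.smult p F) b = poly p (of_nat b) * exp_eval q F b"
  "exp_eval q (Polynomial.monom p n) b = poly p (of_nat b) * (q ^ b) ^ n"
  by (simp_all add: exp_eval_def poly_monom poly_power)

lemma exp_eval_vars [simp]:
  "exp_eval q sigma_var b = q ^ b"
  "exp_eval q tau_var b = of_nat b"
  "exp_eval q (const_var c) b = c"
  by (simp_all add: sigma_var_def tau_var_def const_var_def)

lemma exp_eval_sum [simp]: "exp_eval q (sum f A) b = (\<Sum>i\<in>A. exp_eval q (f i) b)"
  by (induction A rule: infinite_finite_induct) simp_all

lemma exp_eval_altdef:
  "exp_eval q F b =
     (\<Sum>i\<le>Polynomial.degree F. poly (Polynomial.coeff F i) (of_nat b) * (q ^ b) ^ i)"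
  unfolding exp_eval_def poly_altdef[of F] by (simp add: poly_sum poly_power)

text \<open>
  The substitution \<open>F(t + 1, q s)\<close>, which moves the sequence \<open>F(b, q^b)\<close> one step forward.
\<close>
definition shift_var :: "'k::field_char_0 \<Rightarrow> 'k poly poly \<Rightarrow> 'k poly poly" where
  "shift_var q F = pcompose (map_poly (\<lambda>p. pcompose p [:1, 1:]) F) [:0, [:q:]:]"

lemma coeff_shift_var:
  "Polynomial.coeff (shift_var q F) i =
     Polynomial.smult (q ^ i) (pcompose (Polynomial.coeff F i) [:1, 1:])"
proof -
  have "[:q:] ^ i = [:q ^ i:]" by (induction i) simp_all
  then show ?thesis by (simp add: shift_var_def coeff_pcompose_linear coeff_map_poly)
qed

lemma exp_eval_shift_var: "exp_eval q (shift_var q F) b = exp_eval q F (Suc b)"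
proof -
  have "poly (poly (map_poly (\<lambda>p. pcompose p [:1, 1:]) F) [:y:]) t = poly (poly F [:y:]) (t + 1)"
    for y t :: 'a
    by (induction F) (simp_all add: map_poly_pCons poly_pcompose add.commute)
  then show ?thesis
    by (simp add: exp_eval_def shift_var_def poly_pcompose ac_simps)
qed

lemma inj_power_nonzero:
  fixes q :: "'k::field_char_0"
  assumes "inj ((^) q)"
  shows "q \<noteq> 0"
  using injD[OF assms, of 1 2] by auto

text \<open>
  A nonzero \<open>F\<close> with \<open>F(b, q^b) = 0\<close> for all \<open>b\<close> yields another such polynomial,
  \<open>F(t + 1, q s) - q^N F(t, s)\<close> with \<open>N\<close> the degree in \<open>s\<close>.  It has either smaller degree in
  \<open>s\<close> or a leading coefficient of smaller degree in \<open>t\<close>, so descent forces it to vanish.  As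
  the powers of \<open>q\<close> are distinct, only the term of degree \<open>N\<close> then survives in \<open>F\<close>.
\<close>
lemma exp_eval_eq_0_imp:
  fixes q :: "'k::field_char_0"
  assumes inj: "inj ((^) q)" and "\<And>b. exp_eval q F b = 0"
  shows "F = 0"
  using assms(2)
proof (induction F rule: wf_induct_rule[OF wf_measures[of
        "[Polynomial.degree, \<lambda>F. Polynomial.degree (Polynomial.lead_coeff F)]"]])
  case (1 F)
  show ?case
  proof (rule ccontr)
    assume "F \<noteq> 0"
    have "q \<noteq> 0" by (rule inj_power_nonzero[OF inj])
    define N where "N = Polynomial.degree F"
    define p where "p = Polynomial.coeff F"
    define G where "G = shift_var q F - Polynomial.smult [:q ^ N:] F"
    have coeff_G: "Polynomial.coeff G i = difference_op (q ^ i) (q ^ N) (p i)" for i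
      by (simp add: G_def coeff_shift_var difference_op_def p_def)
    have ev_G: "exp_eval q G b = 0" for b
      using 1(2) by (simp add: G_def exp_eval_shift_var)
    have "G = 0"
    proof (rule ccontr)
      assume "G \<noteq> 0"
      have "Polynomial.coeff G i = 0" if "i > N" for i
        using that by (simp add: coeff_G p_def N_def coeff_eq_0 difference_op_def)
      then have "Polynomial.degree G \<le> N" by (simp add: degree_le)
      moreover have "Polynomial.degree (Polynomial.lead_coeff G) < Polynomial.degree (p N)"
        if "Polynomial.degree G = N"
        using degree_difference_op_less[of "q ^ N" "p N"] coeff_G[of N] \<open>G \<noteq> 0\<close> that
        by (metis leading_coeff_neq_0)
      ultimately have "(G, F) \<in> measures
          [Polynomial.degree, \<lambda>F. Polynomial.degree (Polynomial.lead_coeff F)]"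
        by (auto simp: N_def p_def)
      from 1(1)[OF this ev_G] show False using \<open>G \<noteq> 0\<close> by simp
    qed
    have p0: "p i = 0" if "i \<noteq> N" for i
    proof -
      have "(q ^ i - q ^ N) * Polynomial.lead_coeff (p i) = 0"
        using coeff_difference_op_top[of "q ^ i" "q ^ N" "p i"] coeff_G[of i] \<open>G = 0\<close> by simp
      then show ?thesis using injD[OF inj, of i N] that by auto
    qed
    have F: "F = Polynomial.monom (p N) N"
      by (rule poly_eqI) (use p0 in \<open>auto simp: p_def\<close>)
    have "poly (p N) (of_nat b) = 0" for b
      using 1(2)[of b] \<open>q \<noteq> 0\<close> by (subst (asm) F) simp
    then have "range of_nat \<subseteq> {t. poly (p N) t = 0}" by auto
    moreover have "infinite (range (of_nat :: nat \<Rightarrow> 'k))"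
      by (simp add: finite_image_iff inj_of_nat)
    ultimately have "p N = 0" using poly_roots_finite finite_subset by blast
    then show False using F \<open>F \<noteq> 0\<close> by simp
  qed
qed

definition laurent_eval :: "'k::field_char_0 \<Rightarrow> 'k poly poly \<Rightarrow> nat \<Rightarrow> nat \<Rightarrow> 'k" where
  "laurent_eval q F n b = exp_eval q F b / (q ^ b) ^ n"

text \<open>
  The sequences of values of \<open>k[t, s, 1/s]\<close> at the points \<open>(b, q^b)\<close>; every weight of a
  quantum differential operator turns out to be one of them.
\<close>
definition exp_polys :: "'k::field_char_0 \<Rightarrow> (nat \<Rightarrow> 'k) set" where
  "exp_polys q = {laurent_eval q F n | F n. True}"

lemma exp_polysI: "(\<And>b. f b = laurent_eval q F n b) \<Longrightarrow> f \<in> exp_polys q"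
  unfolding exp_polys_def by blast

lemma exp_polysE:
  assumes "f \<in> exp_polys q"
  obtains F n where "f = laurent_eval q F n"
  using assms unfolding exp_polys_def by blast

lemma exp_polys_const: "(\<lambda>_. c) \<in> exp_polys q"
  by (rule exp_polysI[of _ _ "const_var c" 0]) (simp add: laurent_eval_def)

lemma exp_polys_of_nat: "of_nat \<in> exp_polys q"
  by (rule exp_polysI[of _ _ tau_var 0]) (simp add: laurent_eval_def)

lemma laurent_eval_add:
  assumes "q \<noteq> 0"
  shows "laurent_eval q F n b + laurent_eval q G m b =
    laurent_eval q (F * sigma_var ^ m + G * sigma_var ^ n) (n + m) b"
  using assms by (simp add: laurent_eval_def add_frac_eq power_add)

lemma laurent_eval_mult:
  "laurent_eval q F n b * laurent_eval q G m b = laurent_eval q (F * G) (n + m) b"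
  by (simp add: laurent_eval_def power_add)

lemma exp_polys_add:
  assumes "q \<noteq> 0" "f \<in> exp_polys q" "g \<in> exp_polys q"
  shows "(\<lambda>b. f b + g b) \<in> exp_polys q"
  using assms by (elim exp_polysE) (auto intro!: exp_polysI simp: laurent_eval_add)

lemma exp_polys_mult:
  assumes "f \<in> exp_polys q" "g \<in> exp_polys q"
  shows "(\<lambda>b. f b * g b) \<in> exp_polys q"
  using assms by (elim exp_polysE) (auto intro!: exp_polysI simp: laurent_eval_mult)

lemma exp_polys_power_int:
  assumes "q \<noteq> 0"
  shows "(\<lambda>b. q powi (a * int b)) \<in> exp_polys q"
proof (rule exp_polysI)
  fix b
  have "q powi (a * int b) = (q ^ b) powi a"
    by (simp add: mult.commute[of a] power_int_mult)
  also have "\<dots> = (q ^ b) ^ nat a / (q ^ b) ^ nat (- a)"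
    using assms by (cases "a \<ge> 0") (simp_all add: power_int_def field_simps)
  finally show "q powi (a * int b) = laurent_eval q (sigma_var ^ nat a) (nat (- a)) b"
    by (simp add: laurent_eval_def)
qed

lemma exp_polys_Suc:
  assumes "q \<noteq> 0" "f \<in> exp_polys q"
  shows "(\<lambda>b. f (Suc b)) \<in> exp_polys q"
  using assms(2)
proof (elim exp_polysE)
  fix F n assume f: "f = laurent_eval q F n"
  have "f (Suc b) = laurent_eval q (Polynomial.smult [:inverse q ^ n:] (shift_var q F)) n b" for b
    using assms(1)
    by (simp add: f laurent_eval_def exp_eval_shift_var power_mult_distrib field_simps)
  then show ?thesis by (rule exp_polysI)
qed

text \<open>
  Write \<open>\<beta> = q^a\<close>.  A particular solution is found coefficientwise: on \<open>u(b) q^(c b)\<close> the operator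
  \<open>f \<mapsto> f(b + 1) - \<beta> f(b)\<close> acts as \<open>u \<mapsto> q^c u(t + 1) - \<beta> u(t)\<close>, which is surjective on
  polynomials.  The homogeneous solutions are the multiples of \<open>q^(a b)\<close>, so every solution
  is an exponential polynomial.
\<close>
lemma exp_polys_difference_eq:
  assumes q: "q \<noteq> 0"
    and h: "(\<lambda>b. f (Suc b) - q powi a * f b) \<in> exp_polys q"
  shows "f \<in> exp_polys q"
proof -
  obtain F n where F: "(\<lambda>b. f (Suc b) - q powi a * f b) = laurent_eval q F n"
    using h by (elim exp_polysE)
  define \<beta> where "\<beta> = q powi a"
  (* the ratio q^i / q^n is the factor by which the sequence (q^b)^i / (q^b)^n grows *)
  have "\<exists>u. difference_op (q ^ i / q ^ n) \<beta> u = Polynomial.coeff F i" for i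
    by (rule difference_op_surj) (use q in simp)
  then obtain u where u: "\<And>i. difference_op (q ^ i / q ^ n) \<beta> (u i) = Polynomial.coeff F i"
    by metis
  define U where "U = (\<Sum>i\<le>Polynomial.degree F. Polynomial.monom (u i) i)"
  define g where "g = laurent_eval q U n"
  have g: "g b = (\<Sum>i\<le>Polynomial.degree F. poly (u i) (of_nat b) * (q ^ b) ^ i / (q ^ b) ^ n)" for b
    by (simp add: g_def laurent_eval_def U_def sum_divide_distrib)
  have "g (Suc b) - \<beta> * g b = laurent_eval q F n b" for b
  proof -
    have "g (Suc b) - \<beta> * g b = (\<Sum>i\<le>Polynomial.degree F.
        poly (difference_op (q ^ i / q ^ n) \<beta> (u i)) (of_nat b) * (q ^ b) ^ i / (q ^ b) ^ n)"
      unfolding g sum_distrib_left sum_subtractf[symmetric]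
      by (intro sum.cong refl)
        (use q in \<open>simp add: poly_difference_op power_mult_distrib field_simps add.commute\<close>)
    then show ?thesis
      by (simp add: u laurent_eval_def exp_eval_altdef sum_divide_distrib)
  qed
  then have step: "f (Suc b) - g (Suc b) = \<beta> * (f b - g b)" for b
    using fun_cong[OF F, of b] by (simp add: \<beta>_def algebra_simps)
  have "f b - g b = (f 0 - g 0) * q powi (a * int b)" for b
  proof (induction b)
    case (Suc b)
    have "f (Suc b) - g (Suc b) = (f 0 - g 0) * (\<beta> * q powi (a * int b))"
      using step[of b] Suc by simp
    also have "\<beta> * q powi (a * int b) = q powi (a * int (Suc b))"
      using q by (simp add: \<beta>_def power_int_add algebra_simps)
    finally show ?case .
  qed simp
  then have "f = (\<lambda>b. g b + (f 0 - g 0) * q powi (a * int b))"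
    by (metis (lifting) add.commute diff_add_cancel)
  moreover have "g \<in> exp_polys q" unfolding g_def by (rule exp_polysI) simp
  ultimately show ?thesis
    using exp_polys_add[OF q _ exp_polys_mult[OF exp_polys_const exp_polys_power_int[OF q]]]
    by metis
qed

section \<open>Weighted shift operators\<close>

lemma endo_add: "is_endo \<phi> \<Longrightarrow> \<phi> (p + r) = \<phi> p + \<phi> r"
  and endo_smult: "is_endo \<phi> \<Longrightarrow> \<phi> (Polynomial.smult c p) = Polynomial.smult c (\<phi> p)"
  by (simp_all add: is_endo_iff)

text \<open>
  The operator \<open>x^b \<mapsto> f(b) x^(b + d)\<close>.  The truncation \<open>nat (int b + d)\<close> would send
  \<open>x^b\<close> with \<open>b + d < 0\<close> to a constant, so \<open>shift_op d f\<close> is homogeneous of degree \<open>d\<close> only if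
  \<open>f\<close> vanishes at these \<open>b\<close>.
\<close>
definition shift_op :: "int \<Rightarrow> (nat \<Rightarrow> 'k) \<Rightarrow> 'k::field_char_0 poly \<Rightarrow> 'k poly" where
  "shift_op d f p = (\<Sum>b\<le>Polynomial.degree p.
     Polynomial.monom (f b * Polynomial.coeff p b) (nat (int b + d)))"

lemma shift_op_eq_sum:
  assumes "Polynomial.degree p \<le> N"
  shows "shift_op d f p =
    (\<Sum>b\<le>N. Polynomial.monom (f b * Polynomial.coeff p b) (nat (int b + d)))"
  unfolding shift_op_def
  by (rule sum.mono_neutral_left) (use assms in \<open>auto simp: coeff_eq_0\<close>)

lemma is_endo_shift_op: "is_endo (shift_op d f)"
  unfolding is_endo_iff
proof safe
  fix p r :: "'a poly"
  let ?N = "max (Polynomial.degree p) (Polynomial.degree r)"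
  have "Polynomial.degree (p + r) \<le> ?N" by (rule degree_add_le_max)
  then show "shift_op d f (p + r) = shift_op d f p + shift_op d f r"
    by (simp add: shift_op_eq_sum[of _ ?N] sum.distrib[symmetric] add_monom distrib_left)
next
  fix c and p :: "'a poly"
  show "shift_op d f (Polynomial.smult c p) = Polynomial.smult c (shift_op d f p)"
    using degree_smult_le[of c p]
    by (simp add: shift_op_eq_sum[of _ "Polynomial.degree p"] smult_sum_right
        Polynomial.smult_monom mult.left_commute)
qed

lemma shift_op_monom:
  "shift_op d f (Polynomial.monom c b) = Polynomial.monom (f b * c) (nat (int b + d))"
proof -
  have "shift_op d f (Polynomial.monom c b) =
      (\<Sum>i\<le>b. if i = b then Polynomial.monom (f b * c) (nat (int b + d)) else 0)"
    unfolding shift_op_eq_sum[OF degree_monom_le] by (intro sum.cong) auto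
  then show ?thesis by simp
qed

abbreviation diag_op :: "(nat \<Rightarrow> 'k) \<Rightarrow> 'k::field_char_0 poly \<Rightarrow> 'k poly" where
  "diag_op \<equiv> shift_op 0"

lemma diag_op_monom: "diag_op f (Polynomial.monom c b) = Polynomial.monom (f b * c) b"
  by (simp add: shift_op_monom)

lemma coeff_diag_op:
  "Polynomial.coeff (diag_op f p) n = f n * Polynomial.coeff p n"
proof -
  have "Polynomial.coeff (diag_op f p) n =
      (\<Sum>b\<le>Polynomial.degree p. if b = n then f n * Polynomial.coeff p n else 0)"
    unfolding shift_op_def coeff_sum by (auto intro!: sum.cong)
  then show ?thesis by (simp add: coeff_eq_0)
qed

lemma diag_op_eqI:
  "(\<And>p n. Polynomial.coeff (\<phi> p) n = f n * Polynomial.coeff p n) \<Longrightarrow> \<phi> = diag_op f"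
  by (intro ext poly_eqI) (simp add: coeff_diag_op)

lemma diag_op_inject: "diag_op f = diag_op g \<longleftrightarrow> f = g"
proof
  assume "diag_op f = diag_op g"
  then have "Polynomial.coeff (diag_op f (Polynomial.monom 1 b)) b =
      Polynomial.coeff (diag_op g (Polynomial.monom 1 b)) b" for b by simp
  then show "f = g" by (auto simp: coeff_diag_op)
qed simp

lemma sigma_op_diag: "sigma_op q a = diag_op (\<lambda>b. q powi (a * int b))"
  by (rule ext) (simp add: sigma_op_def shift_op_def)

lemma tau_op_diag: "tau_op = diag_op of_nat"
proof (rule diag_op_eqI)
  show "Polynomial.coeff (tau_op p) n = of_nat n * Polynomial.coeff p n" for p :: "'a poly" and n
    by (cases n) (simp_all add: tau_op_def coeff_pderiv)
qed

lemma scalar_op_diag: "scalar_op c = diag_op (\<lambda>_. c)"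
  by (rule diag_op_eqI) (simp add: scalar_op_def)

text \<open>The coefficient of \<open>x^(b + d)\<close> in \<open>\<phi>(x^b)\<close>: the degree-\<open>d\<close> component of \<open>\<phi>\<close>.\<close>
definition weight :: "int \<Rightarrow> ('k::field_char_0 poly \<Rightarrow> 'k poly) \<Rightarrow> nat \<Rightarrow> 'k" where
  "weight d \<phi> b = (if int b + d < 0 then 0
     else Polynomial.coeff (\<phi> (Polynomial.monom 1 b)) (nat (int b + d)))"

lemma zero_in_R_comp [simp]: "0 \<in> R_comp b"
proof -
  have "(0 :: 'a poly) \<in> range (\<lambda>c. Polynomial.monom c (nat b))"
    by (rule image_eqI[of _ _ 0]) simp_all
  then show ?thesis by (simp add: R_comp_def)
qed

lemma R_comp_smult: "p \<in> R_comp b \<Longrightarrow> Polynomial.smult c p \<in> R_comp b"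
  by (auto simp: R_comp_def Polynomial.smult_monom split: if_splits)

lemma homogI:
  fixes \<phi> :: "'k::field_char_0 poly \<Rightarrow> 'k poly"
  assumes "is_endo \<phi>" "\<And>b. \<phi> (Polynomial.monom 1 b) \<in> R_comp (int b + d)"
  shows "homog d \<phi>"
  unfolding homog_def
proof (intro conjI allI image_subsetI assms(1))
  fix b :: int and p :: "'k poly" assume p: "p \<in> R_comp b"
  show "\<phi> p \<in> R_comp (b + d)"
  proof (cases "b \<ge> 0")
    case True
    then obtain c where "p = Polynomial.monom c (nat b)" using p by (auto simp: R_comp_def)
    then have "\<phi> p = Polynomial.smult c (\<phi> (Polynomial.monom 1 (nat b)))"
      using endo_smult[OF assms(1), of c "Polynomial.monom 1 (nat b)"]
      by (simp add: Polynomial.smult_monom)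
    then show ?thesis using R_comp_smult[OF assms(2)[of "nat b"], of c] True by simp
  next
    case False
    then have "p = 0" using p by (simp add: R_comp_def)
    then show ?thesis using endo_smult[OF assms(1), of 0 0] by simp
  qed
qed

lemma homog_shift_op:
  assumes "\<And>b. int b + d < 0 \<Longrightarrow> f b = 0"
  shows "homog d (shift_op d f)"
proof (rule homogI[OF is_endo_shift_op])
  fix b
  show "shift_op d f (Polynomial.monom 1 b) \<in> R_comp (int b + d)"
    using assms[of b] by (auto simp: shift_op_monom R_comp_def)
qed

lemma homog_diag_op: "homog 0 (diag_op f)"
  by (rule homog_shift_op) simp

lemma weight_homog:
  assumes "homog d \<phi>" "e \<noteq> d"
  shows "weight e \<phi> = (\<lambda>_. 0)"
  using homog_coeff[OF assms(1)] assms(2) by (auto simp: weight_def)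

lemma weight_add: "weight d (\<lambda>p. \<phi> p + \<psi> p) = (\<lambda>b. weight d \<phi> b + weight d \<psi> b)"
  by (auto simp: weight_def)

lemma weight_smult: "weight d (\<lambda>p. Polynomial.smult c (\<phi> p)) = (\<lambda>b. c * weight d \<phi> b)"
  by (auto simp: weight_def)

lemma weight_x_left: "weight d (mult_op [:0, 1:] \<circ> \<phi>) = weight (d - 1) \<phi>"
proof
  fix b
  consider "int b + d < 0" | "int b + d = 0" | m where "int b + d = int (Suc m)"
    by (metis linorder_neqE_linordered_idom pos_int_cases not0_implies_Suc of_nat_0_less_iff
        less_numeral_extra(3))
  then show "weight d (mult_op [:0, 1:] \<circ> \<phi>) b = weight (d - 1) \<phi> b"
  proof cases
    case 3
    then have "nat (int b + d) = Suc m" "nat (int b + (d - 1)) = m" by simp_all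
    with 3 show ?thesis by (simp add: weight_def mult_op_def)
  qed (simp_all add: weight_def mult_op_def)
qed

lemma weight_x_right: "weight d (\<phi> \<circ> mult_op [:0, 1:]) b = weight (d - 1) \<phi> (Suc b)"
  by (simp add: weight_def mult_op_def Polynomial.monom_Suc algebra_simps)

lemma endo_monom_weight:
  assumes "int b + d = int n"
  shows "Polynomial.coeff (\<phi> (Polynomial.monom 1 b)) n = weight d \<phi> b"
  using assms by (simp add: weight_def)

section \<open>Graded operators with exponential-polynomial weights\<close>

text \<open>
  An upper bound for every layer of the filtration.  The uniform bound on the degrees with a nonzero
  weight says that the operator is a finite sum of homogeneous ones.
\<close>
definition qexp_ops :: "'k::field_char_0 \<Rightarrow> ('k poly \<Rightarrow> 'k poly) set" where
  "qexp_ops q = {\<phi>. is_endo \<phi> \<and> (\<exists>N. \<forall>d. N < \<bar>d\<bar> \<longrightarrow> weight d \<phi> = (\<lambda>_. 0)) \<and>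
     (\<forall>d. weight d \<phi> \<in> exp_polys q)}"

lemma qexp_opsI:
  assumes "is_endo \<phi>" "\<And>d. N < \<bar>d\<bar> \<Longrightarrow> weight d \<phi> = (\<lambda>_. 0)"
    "\<And>d. weight d \<phi> \<in> exp_polys q"
  shows "\<phi> \<in> qexp_ops q"
  using assms unfolding qexp_ops_def by blast

lemma qexp_opsE:
  assumes "\<phi> \<in> qexp_ops q"
  obtains N where "is_endo \<phi>" "\<And>d. N < \<bar>d\<bar> \<Longrightarrow> weight d \<phi> = (\<lambda>_. 0)"
    "\<And>d. weight d \<phi> \<in> exp_polys q"
proof -
  obtain N where "\<forall>d. N < \<bar>d\<bar> \<longrightarrow> weight d \<phi> = (\<lambda>_. 0)"
    using assms unfolding qexp_ops_def by blast
  then show ?thesis using assms by (intro that[of N]) (simp_all add: qexp_ops_def)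
qed

lemma qexp_ops_add:
  assumes "q \<noteq> 0" "\<phi> \<in> qexp_ops q" "\<psi> \<in> qexp_ops q"
  shows "(\<lambda>p. \<phi> p + \<psi> p) \<in> qexp_ops q"
proof -
  obtain N M where "\<forall>d. N < \<bar>d\<bar> \<longrightarrow> weight d \<phi> = (\<lambda>_. 0)"
      "\<forall>d. M < \<bar>d\<bar> \<longrightarrow> weight d \<psi> = (\<lambda>_. 0)"
    using assms unfolding qexp_ops_def by blast
  then show ?thesis
    using assms exp_polys_add[OF assms(1)]
    by (intro qexp_opsI[of _ "max N M"])
      (simp_all add: qexp_ops_def weight_add is_endo_iff smult_add_right)
qed

lemma qexp_ops_smult:
  assumes "\<phi> \<in> qexp_ops q"
  shows "(\<lambda>p. Polynomial.smult c (\<phi> p)) \<in> qexp_ops q"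
  using assms
proof (rule qexp_opsE)
  fix N assume N: "is_endo \<phi>" "\<And>d. N < \<bar>d\<bar> \<Longrightarrow> weight d \<phi> = (\<lambda>_. 0)"
    "\<And>d. weight d \<phi> \<in> exp_polys q"
  show ?thesis
  proof (rule qexp_opsI[of _ N])
    show "is_endo (\<lambda>p. Polynomial.smult c (\<phi> p))"
      using N(1) by (simp add: is_endo_iff smult_add_right mult.commute)
  qed (simp_all add: weight_smult N exp_polys_mult[OF exp_polys_const])
qed

lemma is_endo_mult_op: "is_endo (mult_op r)"
  by (simp add: is_endo_iff mult_op_def distrib_left)

lemma is_endo_comp: "is_endo \<phi> \<Longrightarrow> is_endo \<psi> \<Longrightarrow> is_endo (\<phi> \<circ> \<psi>)"
  by (simp add: is_endo_iff)

lemma qexp_ops_x_left: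
  assumes "\<phi> \<in> qexp_ops q"
  shows "mult_op [:0, 1:] \<circ> \<phi> \<in> qexp_ops q"
  using assms
proof (rule qexp_opsE)
  fix N assume N: "is_endo \<phi>" "\<And>d. N < \<bar>d\<bar> \<Longrightarrow> weight d \<phi> = (\<lambda>_. 0)"
    "\<And>d. weight d \<phi> \<in> exp_polys q"
  show ?thesis
    by (rule qexp_opsI[of _ "N + 1"]) (simp_all add: weight_x_left N is_endo_comp is_endo_mult_op)
qed

lemma qexp_ops_x_right:
  assumes "q \<noteq> 0" "\<phi> \<in> qexp_ops q"
  shows "\<phi> \<circ> mult_op [:0, 1:] \<in> qexp_ops q"
  using assms(2)
proof (rule qexp_opsE)
  fix N assume N: "is_endo \<phi>" "\<And>d. N < \<bar>d\<bar> \<Longrightarrow> weight d \<phi> = (\<lambda>_. 0)"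
    "\<And>d. weight d \<phi> \<in> exp_polys q"
  have w: "weight d (\<phi> \<circ> mult_op [:0, 1:]) = (\<lambda>b. weight (d - 1) \<phi> (Suc b))" for d
    by (rule ext) (rule weight_x_right)
  show ?thesis
  proof (rule qexp_opsI[of _ "N + 1"])
    show "weight d (\<phi> \<circ> mult_op [:0, 1:]) = (\<lambda>_. 0)" if "N + 1 < \<bar>d\<bar>" for d
      using N(2)[of "d - 1"] that by (simp add: w)
  qed (simp_all only: w exp_polys_Suc[OF assms(1) N(3)] is_endo_comp is_endo_mult_op N(1))
qed

text \<open>
  An operator is the sum of the shifts by its weights, as is seen on monomials.
\<close>
lemma qexp_ops_subset_grHom: "qexp_ops q \<subseteq> grHom"
proof
  fix \<phi> assume \<phi>: "\<phi> \<in> qexp_ops q"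
  then obtain N where N: "\<And>d. N < \<bar>d\<bar> \<Longrightarrow> weight d \<phi> = (\<lambda>_. 0)" and e: "is_endo \<phi>"
    unfolding qexp_ops_def by blast
  let ?\<Phi> = "\<lambda>d. shift_op d (weight d \<phi>)"
  have "\<phi> = (\<lambda>p. \<Sum>d\<in>{-N..N}. ?\<Phi> d p)"
  proof (rule endo_eqI[OF e])
    show "is_endo (\<lambda>p. \<Sum>d\<in>{-N..N}. ?\<Phi> d p)"
      by (simp add: is_endo_iff endo_add[OF is_endo_shift_op] endo_smult[OF is_endo_shift_op]
          sum.distrib smult_sum_right)
  next
    fix b
    show "\<phi> (Polynomial.monom 1 b) = (\<Sum>d\<in>{-N..N}. ?\<Phi> d (Polynomial.monom 1 b))"
    proof (rule poly_eqI)
      fix n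
      have "Polynomial.coeff (\<Sum>d\<in>{-N..N}. ?\<Phi> d (Polynomial.monom 1 b)) n =
          (\<Sum>d\<in>{-N..N}. if d = int n - int b then weight d \<phi> b else 0)"
        unfolding coeff_sum
        by (intro sum.cong refl) (auto simp: shift_op_monom weight_def)
      also have "\<dots> = weight (int n - int b) \<phi> b"
        using N[of "int n - int b"] by (auto simp: fun_eq_iff)
      finally show "Polynomial.coeff (\<phi> (Polynomial.monom 1 b)) n =
          Polynomial.coeff (\<Sum>d\<in>{-N..N}. ?\<Phi> d (Polynomial.monom 1 b)) n"
        by (simp add: endo_monom_weight)
    qed
  qed
  moreover have "homog d (?\<Phi> d)" for d
    by (rule homog_shift_op) (simp add: weight_def)
  ultimately show "\<phi> \<in> grHom"
    unfolding grHom_def by (intro CollectI exI[of _ "{-N..N}"] exI[of _ ?\<Phi>]) simp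
qed

lemma zero_in_qexp_ops: "(\<lambda>_. 0) \<in> qexp_ops q"
proof -
  have "weight d (\<lambda>_. 0) = (\<lambda>_. 0)" for d by (auto simp: weight_def)
  then show ?thesis using exp_polys_const by (auto simp: qexp_ops_def is_endo_iff)
qed

text \<open>
  Horner's rule reduces multiplication by \<open>r\<close> to scalars and multiplication by \<open>x\<close>.  On the left,
  \<open>x\<close> only renumbers the weights; on the right it also moves them one step forward.
\<close>
lemma sub_bimodule_qexp_ops:
  assumes "q \<noteq> 0"
  shows "sub_bimodule (qexp_ops q)"
  unfolding sub_bimodule_def
proof (intro conjI ballI allI qexp_ops_subset_grHom zero_in_qexp_ops)
  show "(\<lambda>p. \<phi> p + \<psi> p) \<in> qexp_ops q" if "\<phi> \<in> qexp_ops q" "\<psi> \<in> qexp_ops q" for \<phi> \<psi>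
    by (rule qexp_ops_add[OF assms that])
next
  fix r \<phi> assume "\<phi> \<in> qexp_ops q"
  then show "mult_op r \<circ> \<phi> \<in> qexp_ops q"
  proof (induction r arbitrary: \<phi>)
    case 0
    then show ?case using zero_in_qexp_ops by (simp add: mult_op_def o_def)
  next
    case (pCons c r)
    have "mult_op (pCons c r) \<circ> \<phi> =
        (\<lambda>p. Polynomial.smult c (\<phi> p) + (mult_op r \<circ> (mult_op [:0, 1:] \<circ> \<phi>)) p)"
      by (simp add: mult_op_def fun_eq_iff)
    then show ?case
      using qexp_ops_add[OF assms qexp_ops_smult[OF pCons.prems]
          pCons.IH[OF qexp_ops_x_left[OF pCons.prems]]] by simp
  qed
next
  fix r \<phi> assume "\<phi> \<in> qexp_ops q"
  then show "\<phi> \<circ> mult_op r \<in> qexp_ops q"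
  proof (induction r arbitrary: \<phi>)
    case 0
    then have "\<phi> 0 = 0" using endo_smult[of \<phi> 0 0] by (simp add: qexp_ops_def)
    then show ?case using zero_in_qexp_ops by (simp add: mult_op_def o_def)
  next
    case (pCons c r)
    then have "is_endo \<phi>" by (simp add: qexp_ops_def)
    then have "\<phi> \<circ> mult_op (pCons c r) =
        (\<lambda>p. Polynomial.smult c (\<phi> p) + ((\<phi> \<circ> mult_op [:0, 1:]) \<circ> mult_op r) p)"
      by (simp add: mult_op_def fun_eq_iff endo_add endo_smult)
    then show ?case
      using qexp_ops_add[OF assms qexp_ops_smult[OF pCons.prems]
          pCons.IH[OF qexp_ops_x_right[OF assms pCons.prems]]] by simp
  qed
qed

section \<open>The weights of a quantum differential operator\<close>

lemma homog_mult_op_monom: "homog (int n) (mult_op (Polynomial.monom c n))"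
  by (rule homogI)
    (auto simp: is_endo_iff mult_op_def distrib_left mult_monom R_comp_def nat_add_distrib add.commute)

text \<open>
  Multiplication by \<open>x^m\<close> is homogeneous of degree \<open>m\<close>, so the twist multiplies the coefficient
  of \<open>x^m\<close> in \<open>r\<close> by \<open>q^(a m)\<close>, just as \<open>\<sigma>_a\<close> does.
\<close>
lemma twist_mult_op: "twist q a (mult_op r) = mult_op (sigma_op q a r)"
proof -
  let ?\<Phi> = "\<lambda>d. mult_op (Polynomial.monom (Polynomial.coeff r (nat d)) (nat d))"
  let ?D = "int ` {..Polynomial.degree r}"
  have "mult_op r p = (\<Sum>d\<in>?D. ?\<Phi> d p)" for p
  proof -
    have "mult_op r p = (\<Sum>i\<le>Polynomial.degree r. Polynomial.monom (Polynomial.coeff r i) i) * p"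
      by (simp add: mult_op_def poly_as_sum_of_monoms)
    then show ?thesis by (simp add: sum.reindex mult_op_def sum_distrib_right)
  qed
  then have "mult_op r = (\<lambda>p. \<Sum>d\<in>?D. ?\<Phi> d p)" by blast
  moreover have "homog d (?\<Phi> d)" if "d \<in> ?D" for d
    using that homog_mult_op_monom[of "nat d"] by auto
  ultimately have "twist q a (mult_op r) =
      (\<lambda>p. \<Sum>d\<in>?D. Polynomial.smult (bichar q a d) (?\<Phi> d p))"
    using twist_sum[of ?D ?\<Phi> q a] by simp
  then show ?thesis
    by (simp add: sum.reindex mult_op_def sigma_op_def sum_distrib_right bichar_def fun_eq_iff
        Polynomial.smult_monom flip: mult_smult_left)
qed

lemma q_bracket_mult_op:
  "q_bracket q a \<phi> (mult_op r) = (\<lambda>p. \<phi> (r * p) - sigma_op q a r * \<phi> p)"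
  by (simp add: q_bracket_def twist_mult_op) (simp add: mult_op_def)

lemma weight_q_bracket_x:
  "weight (d + 1) (q_bracket q a \<phi> (mult_op [:0, 1:])) =
     (\<lambda>b. weight d \<phi> (Suc b) - q powi a * weight d \<phi> b)"
proof
  fix b
  have x: "sigma_op q a [:0, 1:] = Polynomial.smult (q powi a) [:0, 1:]"
    using sigma_op_monom[of q a 1] by (simp add: Polynomial.monom_Suc monom_0)
  have "q_bracket q a \<phi> (mult_op [:0, 1:]) = (\<lambda>p. (\<phi> \<circ> mult_op [:0, 1:]) p +
      Polynomial.smult (- (q powi a)) ((mult_op [:0, 1:] \<circ> \<phi>) p))"
    unfolding q_bracket_mult_op x by (simp add: mult_op_def fun_eq_iff)
  then show "weight (d + 1) (q_bracket q a \<phi> (mult_op [:0, 1:])) b =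
      weight d \<phi> (Suc b) - q powi a * weight d \<phi> b"
    by (simp only: weight_add weight_smult weight_x_left weight_x_right) simp
qed

text \<open>
  The bracket with \<open>x\<close> alone turns membership into the first-order difference equation
  \<open>f(b + 1) - q^a f(b) = h(b)\<close> for the weight \<open>f\<close> of \<open>\<phi>\<close>, whose solutions are exponential
  polynomials if \<open>h\<close> is one.
\<close>
lemma qexp_ops_if_q_bracket:
  assumes "q \<noteq> 0" "homog d \<phi>" "q_bracket q a \<phi> (mult_op [:0, 1:]) \<in> qexp_ops q"
  shows "\<phi> \<in> qexp_ops q"
proof -
  have "weight (d + 1) (q_bracket q a \<phi> (mult_op [:0, 1:])) \<in> exp_polys q"
    using assms(3) by (simp add: qexp_ops_def)
  then have d: "weight d \<phi> \<in> exp_polys q"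
    unfolding weight_q_bracket_x by (rule exp_polys_difference_eq[OF assms(1)])
  show ?thesis
  proof (rule qexp_opsI[of _ "\<bar>d\<bar>"])
    show "is_endo \<phi>" using assms(2) by (simp add: homog_def)
    show "weight e \<phi> = (\<lambda>_. 0)" if "\<bar>d\<bar> < \<bar>e\<bar>" for e
      using weight_homog[OF assms(2), of e] that by fastforce
    show "weight e \<phi> \<in> exp_polys q" for e
      using d weight_homog[OF assms(2), of e] exp_polys_const[of 0 q] by (cases "e = d") simp_all
  qed
qed

lemma bimodule_span_least: "sub_bimodule M \<Longrightarrow> S \<subseteq> M \<Longrightarrow> bimodule_span S \<subseteq> M"
  unfolding bimodule_span_def by blast

lemma bimodule_span_superset: "S \<subseteq> bimodule_span S"
  unfolding bimodule_span_def by blast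

text \<open>
  The bound \<open>M\<close> keeps the family of sub-bimodules containing \<open>S\<close> from being empty, in which case
  its intersection would consist of all functions.
\<close>
lemma sub_bimodule_span:
  assumes "sub_bimodule M" "S \<subseteq> M"
  shows "sub_bimodule (bimodule_span S)"
proof -
  have "bimodule_span S \<subseteq> grHom"
    using bimodule_span_least[OF assms] assms(1) by (auto simp: sub_bimodule_def)
  then show ?thesis by (simp add: sub_bimodule_def bimodule_span_def)
qed

lemma ex_q_bracket_subset_qexp_ops:
  assumes "q \<noteq> 0" "S \<subseteq> qexp_ops q"
  shows "{\<phi>. (\<exists>d. homog d \<phi>) \<and> (\<exists>a. \<forall>r. q_bracket q a \<phi> (mult_op r) \<in> S)} \<subseteq> qexp_ops q"
  using qexp_ops_if_q_bracket[OF assms(1)] assms(2) by blast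

text \<open>
  In this form the bottom layer has the same shape as the others, with the zero operator in the role
  of the preceding layer.
\<close>
lemma Dq_upto_0: "Dq_upto q 0 = bimodule_span
    {\<phi>. (\<exists>d. homog d \<phi>) \<and> (\<exists>a. \<forall>r. q_bracket q a \<phi> (mult_op r) \<in> {\<lambda>_. 0})}"
  by simp

lemma Dq_upto_subset_qexp_ops:
  assumes q: "q \<noteq> 0"
  shows "Dq_upto q n \<subseteq> qexp_ops q"
proof (induction n)
  case 0
  show ?case
    unfolding Dq_upto_0 using zero_in_qexp_ops
    by (intro bimodule_span_least sub_bimodule_qexp_ops ex_q_bracket_subset_qexp_ops q) simp
next
  case (Suc n)
  then show ?case
    unfolding Dq_upto.simps(2)
    by (intro bimodule_span_least sub_bimodule_qexp_ops ex_q_bracket_subset_qexp_ops q)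
qed

lemma sub_bimodule_Dq_upto:
  assumes q: "q \<noteq> 0"
  shows "sub_bimodule (Dq_upto q n)"
proof (cases n)
  case 0
  show ?thesis
    unfolding 0 Dq_upto_0 using zero_in_qexp_ops
    by (intro sub_bimodule_span[OF sub_bimodule_qexp_ops[OF q]] ex_q_bracket_subset_qexp_ops q) simp
next
  case (Suc m)
  show ?thesis
    unfolding Suc Dq_upto.simps(2)
    by (intro sub_bimodule_span[OF sub_bimodule_qexp_ops[OF q]] ex_q_bracket_subset_qexp_ops
        Dq_upto_subset_qexp_ops q)
qed

lemma sub_bimodule_sum:
  assumes "sub_bimodule M" "\<And>i. i \<in> A \<Longrightarrow> \<Phi> i \<in> M"
  shows "(\<lambda>p. \<Sum>i\<in>A. \<Phi> i p) \<in> M"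
  using assms(2)
proof (induction A rule: infinite_finite_induct)
  case (insert i A)
  then show ?case using assms(1) by (simp add: sub_bimodule_def)
qed (use assms(1) in \<open>simp_all add: sub_bimodule_def\<close>)

text \<open>
  Twisting by the same \<open>a\<close> that occurs in the weight \<open>q^(a b) p(b)\<close> cancels the exponential factor:
  the bracket with \<open>x^m\<close> has weight \<open>q^(a m) q^(a b) (p(b + m) - p(b))\<close>, in which \<open>p\<close> is replaced by
  a polynomial of smaller degree.
\<close>
lemma q_bracket_exp_diag_op:
  assumes "q \<noteq> 0"
  shows "q_bracket q a (diag_op (\<lambda>b. q powi (a * int b) * poly p (of_nat b))) (mult_op r) =
    (\<lambda>s. \<Sum>m\<le>Polynomial.degree r.
       (mult_op (Polynomial.monom (q powi (a * int m) * Polynomial.coeff r m) m) \<circ>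
        diag_op (\<lambda>b. q powi (a * int b) * poly (pcompose p [:of_nat m, 1:] - p) (of_nat b))) s)"
  (is "_ = (\<lambda>s. sum (?g s) _)")
proof (rule endo_eqI)
  let ?f = "\<lambda>b. q powi (a * int b) * poly p (of_nat b)"
  show "is_endo (q_bracket q a (diag_op ?f) (mult_op r))"
    by (simp add: q_bracket_mult_op is_endo_iff endo_add[OF is_endo_shift_op]
        endo_smult[OF is_endo_shift_op] distrib_left smult_diff_right)
  show "is_endo (\<lambda>s. sum (?g s) {..Polynomial.degree r})"
    by (simp add: is_endo_iff endo_add[OF is_endo_shift_op] mult_op_def
        endo_smult[OF is_endo_shift_op] distrib_left smult_sum_right sum.distrib)
  fix b
  have "r * Polynomial.monom 1 b =
      (\<Sum>m\<le>Polynomial.degree r. Polynomial.monom (Polynomial.coeff r m) m) * Polynomial.monom 1 b"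
    by (simp add: poly_as_sum_of_monoms)
  also have "\<dots> = (\<Sum>m\<le>Polynomial.degree r. Polynomial.monom (Polynomial.coeff r m) (m + b))"
    by (simp add: sum_distrib_right mult_monom)
  finally have eq1: "diag_op ?f (r * Polynomial.monom 1 b) = (\<Sum>m\<le>Polynomial.degree r.
      Polynomial.monom (?f (m + b) * Polynomial.coeff r m) (m + b))"
    by (simp only: endo_sum[OF is_endo_shift_op] diag_op_monom)
  have eq2: "sigma_op q a r * diag_op ?f (Polynomial.monom 1 b) = (\<Sum>m\<le>Polynomial.degree r.
      Polynomial.monom (q powi (a * int m) * Polynomial.coeff r m * ?f b) (m + b))"
    by (simp add: sigma_op_def diag_op_monom sum_distrib_right mult_monom)
  have eq3: "?f (m + b) * Polynomial.coeff r m - q powi (a * int m) * Polynomial.coeff r m * ?f b =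
      q powi (a * int m) * Polynomial.coeff r m *
        (q powi (a * int b) * poly (pcompose p [:of_nat m, 1:] - p) (of_nat b))" for m
    using assms by (simp add: poly_pcompose power_int_add algebra_simps)
  show "q_bracket q a (diag_op ?f) (mult_op r) (Polynomial.monom 1 b) =
      sum (?g (Polynomial.monom 1 b)) {..Polynomial.degree r}"
    unfolding q_bracket_mult_op eq1 eq2 sum_subtractf[symmetric] diff_monom eq3
    by (simp only: o_def mult_op_def diag_op_monom mult_monom mult_1_right)
qed

lemma exp_diag_op_in_Dq_upto:
  assumes q: "q \<noteq> 0" and "Polynomial.degree p \<le> n"
  shows "diag_op (\<lambda>b. q powi (a * int b) * poly p (of_nat b)) \<in> Dq_upto q n"
  using assms(2)
proof (induction n arbitrary: p)
  case 0
  have "pcompose p [:of_nat m, 1:] - p = 0" for m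
    using 0 by (auto elim: degree_eq_zeroE)
  then have "q_bracket q a (diag_op (\<lambda>b. q powi (a * int b) * poly p (of_nat b))) (mult_op r) =
      (\<lambda>_. 0)" for r
    unfolding q_bracket_exp_diag_op[OF q] by (simp add: shift_op_def mult_op_def)
  then show ?case
    unfolding Dq_upto.simps
    by (intro subsetD[OF bimodule_span_superset]) (use homog_diag_op in blast)
next
  case (Suc n)
  note M = sub_bimodule_Dq_upto[OF q, of n]
  have "q_bracket q a (diag_op (\<lambda>b. q powi (a * int b) * poly p (of_nat b))) (mult_op r)
      \<in> Dq_upto q n" for r
    unfolding q_bracket_exp_diag_op[OF q]
  proof (rule sub_bimodule_sum[OF M])
    fix m
    let ?p = "pcompose p [:of_nat m, 1:] - p"
    have "Polynomial.degree ?p \<le> n"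
      using degree_translate_diff_le[of p "of_nat m"] Suc.prems by linarith
    then have "diag_op (\<lambda>b. q powi (a * int b) * poly ?p (of_nat b)) \<in> Dq_upto q n"
      by (rule Suc.IH)
    then show "mult_op (Polynomial.monom (q powi (a * int m) * Polynomial.coeff r m) m) \<circ>
        diag_op (\<lambda>b. q powi (a * int b) * poly ?p (of_nat b)) \<in> Dq_upto q n"
      using M by (simp add: sub_bimodule_def)
  qed
  then show ?case
    unfolding Dq_upto.simps
    by (intro subsetD[OF bimodule_span_superset]) (use homog_diag_op in blast)
qed

text \<open>
  An operator of degree \<open>0\<close> is determined by its weight of degree \<open>0\<close>.  Conversely, an exponential
  polynomial is a finite sum of terms \<open>q^(a b) p(b)\<close>, and all of them lie in one common layer
  once the layer exceeds the degrees of the coefficients.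
\<close>
lemma Dq_deg0_eq:
  assumes q: "q \<noteq> 0"
  shows "Dq_deg0 q = diag_op ` exp_polys q"
proof (intro equalityI subsetI)
  fix \<phi> assume "\<phi> \<in> Dq_deg0 q"
  then have \<phi>: "homog 0 \<phi>" "\<phi> \<in> qexp_ops q"
    using Dq_upto_subset_qexp_ops[OF q] by (auto simp: Dq_deg0_def Dq_def)
  have "\<phi> = diag_op (weight 0 \<phi>)"
  proof (rule endo_eqI[OF _ is_endo_shift_op])
    show "is_endo \<phi>" using \<phi>(1) by (simp add: homog_def)
    fix b
    show "\<phi> (Polynomial.monom 1 b) = diag_op (weight 0 \<phi>) (Polynomial.monom 1 b)"
    proof (rule poly_eqI)
      fix n
      show "Polynomial.coeff (\<phi> (Polynomial.monom 1 b)) n =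
          Polynomial.coeff (diag_op (weight 0 \<phi>) (Polynomial.monom 1 b)) n"
        using homog_coeff[OF \<phi>(1), of n b 1]
        by (cases "n = b") (simp_all add: coeff_diag_op weight_def)
    qed
  qed
  then show "\<phi> \<in> diag_op ` exp_polys q" using \<phi>(2) by (auto simp: qexp_ops_def)
next
  fix \<phi> assume "\<phi> \<in> diag_op ` exp_polys q"
  then obtain F n where \<phi>: "\<phi> = diag_op (laurent_eval q F n)" by (auto elim: exp_polysE)
  (* any common bound for the degrees of the coefficients of F would do *)
  define N where "N = (\<Sum>i\<le>Polynomial.degree F. Polynomial.degree (Polynomial.coeff F i))"
  let ?\<Phi> = "\<lambda>i. diag_op (\<lambda>b. q powi ((int i - int n) * int b) * poly (Polynomial.coeff F i) (of_nat b))"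
  have "laurent_eval q F n b = (\<Sum>i\<le>Polynomial.degree F.
      q powi ((int i - int n) * int b) * poly (Polynomial.coeff F i) (of_nat b))" for b
  proof -
    have "q powi ((int i - int n) * int b) = (q ^ b) ^ i / (q ^ b) ^ n" for i
      using q by (simp add: mult.commute[of _ "int b"] power_int_mult power_int_diff)
    then show ?thesis
      by (simp add: laurent_eval_def exp_eval_altdef sum_divide_distrib mult.commute)
  qed
  then have "\<phi> = (\<lambda>p. \<Sum>i\<le>Polynomial.degree F. ?\<Phi> i p)"
    unfolding \<phi> by (intro diag_op_eqI[symmetric])
      (simp add: coeff_sum coeff_diag_op sum_distrib_right)
  moreover have "?\<Phi> i \<in> Dq_upto q N" if "i \<in> {..Polynomial.degree F}" for i
    using that unfolding N_def by (intro exp_diag_op_in_Dq_upto[OF q] member_le_sum) auto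
  ultimately have "\<phi> \<in> Dq_upto q N"
    using sub_bimodule_sum[OF sub_bimodule_Dq_upto[OF q], of _ ?\<Phi>] by blast
  then show "\<phi> \<in> Dq_deg0 q" using homog_diag_op \<phi> by (auto simp: Dq_deg0_def Dq_def)
qed

section \<open>The ring of diagonal operators\<close>

lemma End_ring_simps [simp]:
  "carrier End_ring = Collect is_endo"
  "\<phi> \<otimes>\<^bsub>End_ring\<^esub> \<psi> = \<phi> \<circ> \<psi>"
  "\<one>\<^bsub>End_ring\<^esub> = id"
  "\<zero>\<^bsub>End_ring\<^esub> = (\<lambda>_. 0)"
  "\<phi> \<oplus>\<^bsub>End_ring\<^esub> \<psi> = (\<lambda>p. \<phi> p + \<psi> p)"
  by (simp_all add: End_ring_def)

lemma ring_End_ring: "ring (End_ring :: ('k::field_char_0 poly \<Rightarrow> 'k poly) ring)"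
proof (rule ringI)
  show "abelian_group (End_ring :: ('k poly \<Rightarrow> 'k poly) ring)"
  proof (rule abelian_groupI)
    fix \<phi> :: "'k poly \<Rightarrow> 'k poly" assume "\<phi> \<in> carrier End_ring"
    then show "\<exists>\<psi>\<in>carrier End_ring. \<psi> \<oplus>\<^bsub>End_ring\<^esub> \<phi> = \<zero>\<^bsub>End_ring\<^esub>"
      by (intro bexI[of _ "\<lambda>p. - \<phi> p"]) (simp_all add: is_endo_iff)
  qed (simp_all add: is_endo_iff smult_add_right add_ac)
  show "monoid (End_ring :: ('k poly \<Rightarrow> 'k poly) ring)"
    by (rule monoidI) (simp_all add: is_endo_iff o_assoc)
qed (simp_all add: is_endo_iff o_def)

lemma diag_op_0: "diag_op (\<lambda>_. 0) = (\<lambda>_. 0)"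
  by (rule diag_op_eqI[symmetric]) simp

lemma diag_op_1: "diag_op (\<lambda>_. 1) = id"
  by (rule diag_op_eqI[symmetric]) simp

lemma diag_op_add: "diag_op (\<lambda>b. f b + g b) = (\<lambda>p. diag_op f p + diag_op g p)"
  by (rule diag_op_eqI[symmetric]) (simp add: coeff_diag_op distrib_right)

lemma diag_op_mult: "diag_op (\<lambda>b. f b * g b) = diag_op f \<circ> diag_op g"
  by (rule diag_op_eqI[symmetric]) (simp add: coeff_diag_op)

lemma subring_diag_exp_polys:
  assumes "q \<noteq> 0"
  shows "subring (diag_op ` exp_polys q) End_ring"
proof -
  interpret E: ring "End_ring :: ('a poly \<Rightarrow> 'a poly) ring" by (rule ring_End_ring)
  show ?thesis
  proof (rule E.subringI)
    show "diag_op ` exp_polys q \<subseteq> carrier End_ring" by (auto simp: is_endo_shift_op)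
    show "\<one>\<^bsub>End_ring\<^esub> \<in> diag_op ` exp_polys q"
      using exp_polys_const[of 1 q] by (auto simp: diag_op_1[symmetric])
  next
    fix \<phi> assume "\<phi> \<in> diag_op ` exp_polys q"
    then obtain f where f: "f \<in> exp_polys q" "\<phi> = diag_op f" by blast
    have "diag_op (\<lambda>b. -1 * f b) \<oplus>\<^bsub>End_ring\<^esub> \<phi> = \<zero>\<^bsub>End_ring\<^esub>"
      by (simp add: f(2) diag_op_add[symmetric] diag_op_0)
    then have "\<ominus>\<^bsub>End_ring\<^esub> \<phi> = diag_op (\<lambda>b. -1 * f b)"
      by (intro E.minus_equality) (simp_all add: f(2) is_endo_shift_op)
    then show "\<ominus>\<^bsub>End_ring\<^esub> \<phi> \<in> diag_op ` exp_polys q"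
      by (simp only:) (intro imageI exp_polys_mult exp_polys_const f(1))
  next
    fix \<phi> \<psi> assume "\<phi> \<in> diag_op ` exp_polys q" "\<psi> \<in> diag_op ` exp_polys q"
    then obtain f g where fg: "f \<in> exp_polys q" "\<phi> = diag_op f" "g \<in> exp_polys q" "\<psi> = diag_op g"
      by blast
    show "\<phi> \<otimes>\<^bsub>End_ring\<^esub> \<psi> \<in> diag_op ` exp_polys q"
      using exp_polys_mult[OF fg(1,3)] by (auto simp: fg(2,4) diag_op_mult[symmetric])
    show "\<phi> \<oplus>\<^bsub>End_ring\<^esub> \<psi> \<in> diag_op ` exp_polys q"
      using exp_polys_add[OF assms fg(1,3)] by (auto simp: fg(2,4) diag_op_add[symmetric])
  qed
qed

lemma subcring_diag_exp_polys:
  assumes "q \<noteq> 0"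
  shows "subcring (diag_op ` exp_polys q) End_ring"
proof (rule ring.subcringI[OF ring_End_ring subring_diag_exp_polys[OF assms]])
  fix \<phi> \<psi> assume "\<phi> \<in> diag_op ` exp_polys q" "\<psi> \<in> diag_op ` exp_polys q"
  then show "\<phi> \<otimes>\<^bsub>End_ring\<^esub> \<psi> = \<psi> \<otimes>\<^bsub>End_ring\<^esub> \<phi>"
    by (auto simp: diag_op_mult[symmetric] mult.commute)
qed

lemma sigma_op_1_diag: "sigma_op q 1 = diag_op (\<lambda>b. q ^ b)"
  by (simp add: sigma_op_diag)

lemma sigma_op_neg_1_diag: "sigma_op q (-1) = diag_op (\<lambda>b. inverse (q ^ b))"
  by (simp add: sigma_op_diag power_int_minus)

text \<open>
  A subring containing the generators contains \<open>diag_op\<close> of every \<open>F(b, q^b) / q^(n b)\<close>, by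
  Horner's rule: one induction for the inner polynomials in \<open>\<tau>\<close>, one for the outer polynomial
  in \<open>\<sigma>\<close>, and one for the power of \<open>\<sigma>^(-1)\<close>.
\<close>
lemma diag_exp_polys_least:
  assumes K: "subring K End_ring"
    and gen: "range scalar_op \<union> {sigma_op q 1, tau_op, sigma_op q (-1)} \<subseteq> K"
  shows "diag_op ` exp_polys q \<subseteq> K"
proof -
  have add: "diag_op (\<lambda>b. f b + g b) \<in> K" if "diag_op f \<in> K" "diag_op g \<in> K" for f g
    using subringE(7)[OF K that] by (simp add: diag_op_add)
  have mult: "diag_op (\<lambda>b. f b * g b) \<in> K" if "diag_op f \<in> K" "diag_op g \<in> K" for f g
    using subringE(6)[OF K that] by (simp add: diag_op_mult)
  have const: "diag_op (\<lambda>_. c) \<in> K" for c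
    using gen by (auto simp: scalar_op_diag)
  have gens: "diag_op of_nat \<in> K" "diag_op (\<lambda>b. q ^ b) \<in> K" "diag_op (\<lambda>b. inverse (q ^ b)) \<in> K"
    using gen by (simp_all add: tau_op_diag sigma_op_1_diag sigma_op_neg_1_diag)
  have poly: "diag_op (\<lambda>b. poly p (of_nat b)) \<in> K" for p
    by (induction p) (simp_all add: const add mult gens)
  have ev: "diag_op (exp_eval q F) \<in> K" for F
  proof (induction F)
    case 0
    then show ?case using const[of 0] by (simp add: exp_eval_def)
  next
    case (pCons p F)
    have "exp_eval q (pCons p F) = (\<lambda>b. poly p (of_nat b) + q ^ b * exp_eval q F b)"
      by (rule ext) simp
    then show ?case using add[OF poly mult[OF gens(2) pCons(2)]] by simp
  qed
  have "diag_op (\<lambda>b. inverse (q ^ b) ^ n) \<in> K" for n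
    by (induction n) (simp_all add: const mult gens)
  then have "diag_op (\<lambda>b. exp_eval q F b * inverse (q ^ b) ^ n) \<in> K" for F n
    by (rule mult[OF ev])
  moreover have "laurent_eval q F n = (\<lambda>b. exp_eval q F b * inverse (q ^ b) ^ n)" for F n
    by (rule ext) (simp add: laurent_eval_def divide_inverse power_inverse)
  ultimately show ?thesis by (auto elim!: exp_polysE)
qed

lemma diag_exp_polys_eq_generate_ring:
  assumes "q \<noteq> 0"
  shows "diag_op ` exp_polys q = generate_ring End_ring
    (range scalar_op \<union> {sigma_op q 1, tau_op, sigma_op q (-1)})"
proof (rule ring.generate_ringI[OF ring_End_ring _ subring_diag_exp_polys[OF assms]])
  let ?G = "range scalar_op \<union> {sigma_op q 1, tau_op, sigma_op q (-1)}"
  have "diag_op (\<lambda>b. q powi (a * int b)) \<in> diag_op ` exp_polys q" for a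
    using exp_polys_power_int[OF assms] by blast
  then have "sigma_op q a \<in> diag_op ` exp_polys q" for a
    by (simp only: sigma_op_diag)
  moreover have "scalar_op c \<in> diag_op ` exp_polys q" for c
    unfolding scalar_op_diag by (intro imageI exp_polys_const)
  moreover have "tau_op \<in> diag_op ` exp_polys q"
    unfolding tau_op_diag by (intro imageI exp_polys_of_nat)
  ultimately show "?G \<subseteq> diag_op ` exp_polys q" by blast
  then show "?G \<subseteq> carrier End_ring"
    by (auto simp: is_endo_shift_op scalar_op_diag tau_op_diag sigma_op_diag)
qed (rule diag_exp_polys_least)

section \<open>The localized polynomial ring\<close>

text \<open>
  Two representations of the same fraction give the same operator by \<open>laurent_eval_eq_iff\<close>, so the
  description is unique when the powers of \<open>q\<close> are distinct.
\<close>
definition fract_op :: "'k::field_char_0 \<Rightarrow> 'k poly poly fract \<Rightarrow> 'k poly \<Rightarrow> 'k poly" where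
  "fract_op q z = (THE \<phi>. \<exists>F n. z = Fract F (sigma_var ^ n) \<and> \<phi> = diag_op (laurent_eval q F n))"

lemma sigma_var_nz [simp]: "sigma_var \<noteq> 0"
  by (simp add: sigma_var_def)

text \<open>
  Clearing denominators turns equality of the sequences into the vanishing of
  \<open>F s^m - G s^n\<close> at all points \<open>(b, q^b)\<close>, hence as a polynomial.
\<close>
lemma laurent_eval_eq_iff:
  assumes inj: "inj ((^) q)"
  shows "laurent_eval q F n = laurent_eval q G m \<longleftrightarrow>
    Fract F (sigma_var ^ n) = Fract G (sigma_var ^ m)"
proof -
  note q = inj_power_nonzero[OF inj]
  have "laurent_eval q F n = laurent_eval q G m \<longleftrightarrow>
      (\<forall>b. exp_eval q (F * sigma_var ^ m - G * sigma_var ^ n) b = 0)"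
    using q by (simp add: fun_eq_iff laurent_eval_def frac_eq_eq)
  also have "\<dots> \<longleftrightarrow> F * sigma_var ^ m - G * sigma_var ^ n = 0"
    by (metis exp_eval_eq_0_imp[OF inj] exp_eval_simps(1))
  also have "\<dots> \<longleftrightarrow> Fract F (sigma_var ^ n) = Fract G (sigma_var ^ m)"
    by (simp add: eq_fract)
  finally show ?thesis .
qed

lemma fract_op_Fract:
  assumes inj: "inj ((^) q)"
  shows "fract_op q (Fract F (sigma_var ^ n)) = diag_op (laurent_eval q F n)"
  unfolding fract_op_def
proof (rule the_equality)
  fix \<phi> assume "\<exists>G m. Fract F (sigma_var ^ n) = Fract G (sigma_var ^ m) \<and>
    \<phi> = diag_op (laurent_eval q G m)"
  then show "\<phi> = diag_op (laurent_eval q F n)"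
    using laurent_eval_eq_iff[OF inj] by metis
qed blast

lemma fract_op_ring_iso:
  fixes q :: "'k::field_char_0"
  assumes inj: "inj ((^) q)"
  shows "fract_op q \<in> ring_iso (localization_at sigma_var)
    (End_ring\<lparr>carrier := diag_op ` exp_polys q\<rparr>)"
proof -
  note q = inj_power_nonzero[OF inj]
  note op = fract_op_Fract[OF inj]
  let ?C = "{Fract F (sigma_var ^ n :: 'k poly poly) | F n. True}"
  have hom: "fract_op q (x * y) = fract_op q x \<circ> fract_op q y"
    "fract_op q (x + y) = (\<lambda>p. fract_op q x p + fract_op q y p)"
    if C: "x \<in> ?C" "y \<in> ?C" for x y
  proof -
    obtain F n where x: "x = Fract F (sigma_var ^ n)" using C(1) by blast
    obtain G m where y: "y = Fract G (sigma_var ^ m)" using C(2) by blast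
    note xy = x y
    have "x * y = Fract (F * G) (sigma_var ^ (n + m))"
      by (simp add: xy power_add)
    moreover have "laurent_eval q (F * G) (n + m) = (\<lambda>b. laurent_eval q F n b * laurent_eval q G m b)"
      by (simp add: laurent_eval_mult)
    ultimately show "fract_op q (x * y) = fract_op q x \<circ> fract_op q y"
      by (simp only: op xy diag_op_mult)
    have "x + y = Fract (F * sigma_var ^ m + G * sigma_var ^ n) (sigma_var ^ (n + m))"
      by (simp add: xy power_add)
    moreover have "laurent_eval q (F * sigma_var ^ m + G * sigma_var ^ n) (n + m) =
        (\<lambda>b. laurent_eval q F n b + laurent_eval q G m b)"
      by (simp add: laurent_eval_add[OF q])
    ultimately show "fract_op q (x + y) = (\<lambda>p. fract_op q x p + fract_op q y p)"
      by (simp only: op xy diag_op_add)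
  qed
  have one: "fract_op q 1 = id"
    using op[of 1 0] by (simp add: One_fract_def laurent_eval_def[abs_def] diag_op_1)
  have image: "fract_op q ` ?C = diag_op ` exp_polys q"
  proof (intro equalityI subsetI)
    show "\<phi> \<in> diag_op ` exp_polys q" if "\<phi> \<in> fract_op q ` ?C" for \<phi>
      using that by (auto simp: op intro!: imageI exp_polysI)
    fix \<phi> assume "\<phi> \<in> diag_op ` exp_polys q"
    then obtain F n where "\<phi> = diag_op (laurent_eval q F n)" by (auto elim: exp_polysE)
    then have "\<phi> = fract_op q (Fract F (sigma_var ^ n))" by (simp only: op)
    then show "\<phi> \<in> fract_op q ` ?C" by blast
  qed
  have "inj_on (fract_op q) ?C"
    by (rule inj_onI) (auto simp: op diag_op_inject laurent_eval_eq_iff[OF inj])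
  then have "bij_betw (fract_op q) ?C (diag_op ` exp_polys q)"
    using image by (simp add: bij_betw_def)
  moreover have "fract_op q \<in> ?C \<rightarrow> diag_op ` exp_polys q"
    using image by blast
  ultimately show ?thesis
    using hom one by (simp add: ring_iso_def ring_hom_def localization_at_def End_ring_def)
qed

text \<open>
  A coincidence \<open>q^i = q^j\<close> would make \<open>q\<close> a root of \<open>x^i - x^j\<close>.
\<close>
lemma inj_power_if_not_algebraic:
  fixes q :: "'k::field_char_0"
  assumes "\<not> algebraic q"
  shows "inj ((^) q)"
proof (rule injI, rule ccontr)
  fix i j assume "q ^ i = q ^ j" "i \<noteq> j"
  let ?p = "Polynomial.monom 1 i - Polynomial.monom 1 j :: 'k poly"
  have "Polynomial.coeff ?p i \<noteq> 0" using \<open>i \<noteq> j\<close> by simp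
  then have "?p \<noteq> 0" by force
  moreover have "Polynomial.coeff ?p n \<in> \<int>" for n by auto
  moreover have "poly ?p q = 0" using \<open>q ^ i = q ^ j\<close> by (simp add: poly_monom)
  ultimately show False using assms algebraicI by blast
qed

theorem lemma3p0p1:
  fixes q :: "'k::field_char_0"
  assumes "\<not> algebraic q"
  shows "subcring (Dq_deg0 q) End_ring
    \<and> Dq_deg0 q = generate_ring End_ring
        (range scalar_op \<union> {sigma_op q 1, tau_op, sigma_op q (-1)})
    \<and> (\<exists>\<Theta>. \<Theta> \<in> ring_iso (localization_at (sigma_var :: 'k poly poly))
                             (End_ring\<lparr>carrier := Dq_deg0 q\<rparr>)
          \<and> (\<forall>c. \<Theta> (Fract (const_var c) 1) = scalar_op c)
          \<and> \<Theta> (Fract tau_var 1) = tau_op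
          \<and> \<Theta> (Fract sigma_var 1) = sigma_op q 1
          \<and> \<Theta> (Fract 1 sigma_var) = sigma_op q (-1))"
proof -
  note inj = inj_power_if_not_algebraic[OF assms]
  note q = inj_power_nonzero[OF inj]
  have op: "fract_op q (Fract F 1) = diag_op (exp_eval q F)" for F
    using fract_op_Fract[OF inj, of F 0] by (simp add: laurent_eval_def[abs_def])
  have "fract_op q (Fract (const_var c) 1) = scalar_op c" for c
    by (simp add: op scalar_op_diag exp_eval_vars[abs_def])
  moreover have "fract_op q (Fract tau_var 1) = tau_op"
    by (simp add: op tau_op_diag exp_eval_vars[abs_def])
  moreover have "fract_op q (Fract sigma_var 1) = sigma_op q 1"
    by (simp add: op sigma_op_1_diag exp_eval_vars[abs_def])
  moreover have "fract_op q (Fract 1 sigma_var) = sigma_op q (-1)"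
    using fract_op_Fract[OF inj, of 1 1]
    by (simp add: sigma_op_neg_1_diag laurent_eval_def[abs_def] divide_inverse)
  ultimately show ?thesis
    using subcring_diag_exp_polys[OF q] diag_exp_polys_eq_generate_ring[OF q]
      fract_op_ring_iso[OF inj]
    unfolding Dq_deg0_eq[OF q] by blast
qed

end
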